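(* Let $\mathcal{C}$ be a finite abstract simplicial complex, let $\mathcal{V}=\{V_1,\ldots,V_n\}$ be a partition of $V(\mathcal{C})$, and let $m\ge 0$ be an integer. If $\eta_H(\mathcal{C}[V_I])\ge |I|+m$ for all nonempty $I\subseteq[n]$, where $V_I=\bigcup_{i\in I}V_i$, then $\eta_H(\mathbf{Col}(\mathcal{C},\mathcal{V}))\ge m+1$.
   Context: $\mathcal{C}[X]=\{\sigma\in\mathcal{C}:\sigma\subseteq X\}$. $\eta_H(\mathcal{K})$ is $2$ plus the largest $k\ge -2$ such that $\widetilde H_j(\mathcal{K};\mathbb{Q})=0$ for all $-1\le j\le k$ (where $\widetilde H_{-1}=0$ means $\mathcal{K}$ has at least one vertex), possibly $\infty$. The colorful complex $\mathbf{Col}(\mathcal{C},\mathcal{V})$ is the simplicial complex whose vertices are the simplices $\sigma\in\mathcal{C}$ that contain at least one vertex of every class $V_i$, and whose simplices are the sets $\{\sigma_1,\ldots,\sigma_\ell\}$ of such simplices forming a chain $\sigma_1\subset\cdots\subset\sigma_\ell$. *)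

theory Defs
  imports "HOL-Combinatorics.Permutations" "HOL-Library.Extended_Nat"
begin

definition simplicial_complex :: "'a set set \<Rightarrow> bool" where
  "simplicial_complex K \<longleftrightarrow> finite K \<and> (\<forall>\<sigma>\<in>K. finite \<sigma>) \<and> (\<forall>\<sigma>\<in>K. \<forall>\<tau>. \<tau> \<subseteq> \<sigma> \<longrightarrow> \<tau> \<in> K)"

definition induced :: "'a set set \<Rightarrow> 'a set \<Rightarrow> 'a set set" where
  "induced K X = {\<sigma> \<in> K. \<sigma> \<subseteq> X}"

text \<open>Augmented oriented simplicial chains with rational coefficients in degree j:
  alternating functions on ordered lists of distinct vertices spanning a simplex
  (the empty list is the unique simplex of degree -1).\<close>
definition chains :: "'a set set \<Rightarrow> int \<Rightarrow> ('a list \<Rightarrow> rat) set" where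
  "chains K j = {c. (\<forall>xs. c xs \<noteq> 0 \<longrightarrow> distinct xs \<and> (xs = [] \<or> set xs \<in> K) \<and> int (length xs) = j + 1)
      \<and> (\<forall>xs p. p permutes {..<length xs} \<longrightarrow> c (permute_list p xs) = of_int (sign p) * c xs)}"

definition bdry :: "'a set set \<Rightarrow> ('a list \<Rightarrow> rat) \<Rightarrow> ('a list \<Rightarrow> rat)" where
  "bdry K c = (\<lambda>ys. \<Sum>v\<in>\<Union>K. c (v # ys))"

definition red_hom_vanishes :: "'a set set \<Rightarrow> int \<Rightarrow> bool" where
  "red_hom_vanishes K j \<longleftrightarrow>
     (\<forall>c\<in>chains K j. bdry K c = (\<lambda>_. 0) \<longrightarrow> (\<exists>d\<in>chains K (j + 1). bdry K d = c))"

definition eta_H :: "'a set set \<Rightarrow> enat" where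
  "eta_H K = Sup {enat (nat (k + 2)) | k. k \<ge> -2 \<and> (\<forall>j. -1 \<le> j \<and> j \<le> k \<longrightarrow> red_hom_vanishes K j)}"

definition col_vertices :: "'a set set \<Rightarrow> (nat \<Rightarrow> 'a set) \<Rightarrow> nat \<Rightarrow> 'a set set" where
  "col_vertices K V n = {\<sigma> \<in> K. \<forall>i\<in>{1..n}. \<sigma> \<inter> V i \<noteq> {}}"

definition Col :: "'a set set \<Rightarrow> (nat \<Rightarrow> 'a set) \<Rightarrow> nat \<Rightarrow> 'a set set set" where
  "Col K V n = {S. S \<subseteq> col_vertices K V n \<and> (\<forall>a\<in>S. \<forall>b\<in>S. a \<subseteq> b \<or> b \<subseteq> a)}"

end

theory Submission
  imports Defs
begin

text \<open>
  Write \<open>U\<^sub>i\<close> for the set of simplices of \<open>C\<close> meeting \<open>V\<^sub>i\<close> and \<open>K\<^sub>i\<close> for its order complex. Since the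
  \<open>U\<^sub>i\<close> are closed upwards, the union of the \<open>K\<^sub>i\<close> over \<open>J\<close> is the order complex of the
  simplices meeting \<open>V\<^sub>J\<close>, which has the homology of \<open>C[V\<^sub>J]\<close>; the intersection of all \<open>K\<^sub>i\<close> is
  the colorful complex. So the hypothesis concerns unions of the \<open>K\<^sub>i\<close> and the conclusion their
  intersection, and one passes from the former to the latter by repeated Mayer--Vietoris arguments.
\<close>

subsection \<open>Alternating chains\<close>

text \<open>Induction on the segment between the two entries: \<open>x\<close> passes its head
  \<open>z\<close>, the shorter segment is covered by induction, and \<open>y\<close> passes
  \<open>z\<close>. Three sign changes amount to one.\<close>

lemma alternating_swap:
  fixes f :: "'a list \<Rightarrow> rat"
  assumes "\<And>us x y vs. f (us @ x # y # vs) = - f (us @ y # x # vs)"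
  shows "f (us @ x # vs @ y # ws) = - f (us @ y # vs @ x # ws)"
proof (induction vs arbitrary: us)
  case Nil
  show ?case using assms[of us x y ws] by simp
next
  case (Cons z vs)
  have "f (us @ x # (z # vs) @ y # ws) = - f ((us @ [z]) @ x # vs @ y # ws)"
    using assms[of us x z "vs @ y # ws"] by simp
  also have "\<dots> = f ((us @ [z]) @ y # vs @ x # ws)"
    using Cons[of "us @ [z]"] by simp
  also have "\<dots> = - f (us @ y # (z # vs) @ x # ws)"
    using assms[of us z y "vs @ x # ws"] by simp
  finally show ?case .
qed

lemma permute_list_transpose_append:
  "permute_list (Transposition.transpose (length us) (Suc (length us + length vs)))
     (us @ x # vs @ y # ws) = us @ y # vs @ x # ws"
proof (rule nth_equalityI)
  fix i
  assume "i < length (permute_list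
    (Transposition.transpose (length us) (Suc (length us + length vs))) (us @ x # vs @ y # ws))"
  then have i: "i < length us + length vs + length ws + 2" by simp
  then show "permute_list (Transposition.transpose (length us) (Suc (length us + length vs)))
      (us @ x # vs @ y # ws) ! i = (us @ y # vs @ x # ws) ! i"
    by (subst permute_list_nth)
      (use i in \<open>auto simp: Transposition.transpose_def nth_append nth_Cons' intro: permutes_swap_id\<close>)
qed simp

text \<open>Every permutation of the positions is a product of transpositions, and each
  transposition negates both the value of \<open>f\<close> (by \<open>alternating_swap\<close>) and
  the sign.\<close>

lemma alternating_permute:
  fixes f :: "'a list \<Rightarrow> rat"
  assumes alt: "\<And>us x y vs. f (us @ x # y # vs) = - f (us @ y # x # vs)"
    and p: "p permutes {..<length xs}"
  shows "f (permute_list p xs) = of_int (sign p) * f xs"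
proof -
  have tr: "f (permute_list (Transposition.transpose a b) ys) = - f ys"
    if "a < b" "b < length ys" for a b and ys :: "'a list"
  proof -
    define us where "us = take a ys"
    define vs where "vs = take (b - Suc a) (drop (Suc a) ys)"
    define ws where "ws = drop (Suc b) ys"
    have "drop (Suc a) ys = vs @ drop b ys"
      unfolding vs_def using that
      by (metis Suc_leI append_take_drop_id drop_drop le_add_diff_inverse2)
    then have ys: "ys = us @ ys ! a # vs @ ys ! b # ws"
      unfolding us_def ws_def using that
      by (metis Cons_nth_drop_Suc append_take_drop_id order.strict_trans)
    have len: "length us = a" "Suc (length us + length vs) = b"
      using that by (auto simp: us_def vs_def)
    show ?thesis
      using permute_list_transpose_append[of us vs "ys ! a" "ys ! b" ws]
        alternating_swap[of f us "ys ! a" vs "ys ! b" ws, OF alt] ys len by simp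
  qed
  have tr': "f (permute_list (Transposition.transpose a b) ys) = - f ys"
    if "a \<noteq> b" "a < length ys" "b < length ys" for a b and ys :: "'a list"
    using tr[of a b ys] tr[of b a ys] that
    by (cases a b rule: linorder_cases) (auto simp: transpose_commute)
  have "finite {..<length xs}" by simp
  from this p show ?thesis
  proof (induction rule: permutes_rev_induct)
    case id
    then show ?case by simp
  next
    case (swap a b p)
    let ?t = "Transposition.transpose a b"
    have t: "?t permutes {..<length xs}"
      using swap by (intro permutes_swap_id) auto
    have "permutation p" "permutation ?t"
      using swap(4) t by (auto simp: permutation_permutes)
    then have sgn: "sign (p \<circ> ?t) = - sign p"
      using swap(3) by (simp add: sign_compose sign_swap_id)
    have "f (permute_list (p \<circ> ?t) xs) = - f (permute_list p xs)"
      using tr'[of a b "permute_list p xs"] swap(1-3)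
      unfolding permute_list_compose[OF t] by simp
    also have "\<dots> = of_int (sign (p \<circ> ?t)) * f xs"
      unfolding sgn using swap(5) by simp
    finally show ?case .
  qed
qed

text \<open>Trades the condition on all permutations for the sign rule on adjacent entries, which
  can be checked directly on lists. Later proofs that a function is a chain rest on this
  form.\<close>

lemma chains_iff:
  "c \<in> chains K j \<longleftrightarrow>
    (\<forall>xs. c xs \<noteq> 0 \<longrightarrow> distinct xs \<and> (xs = [] \<or> set xs \<in> K) \<and> int (length xs) = j + 1) \<and>
    (\<forall>us x y vs. c (us @ x # y # vs) = - c (us @ y # x # vs))"
proof -
  have adj: "c (us @ x # y # vs) = - c (us @ y # x # vs)"
    if "\<forall>xs p. p permutes {..<length xs} \<longrightarrow> c (permute_list p xs) = of_int (sign p) * c xs"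
    for us x y vs
  proof -
    let ?p = "Transposition.transpose (length us) (Suc (length us))"
    have "?p permutes {..<length (us @ y # x # vs)}"
      by (intro permutes_swap_id) auto
    then show ?thesis
      using that[rule_format, of ?p "us @ y # x # vs"]
        permute_list_transpose_append[of us "[]" y x vs]
      by (simp add: sign_swap_id)
  qed
  have eq: "(\<forall>xs p. p permutes {..<length xs} \<longrightarrow> c (permute_list p xs) = of_int (sign p) * c xs)
      \<longleftrightarrow> (\<forall>us x y vs. c (us @ x # y # vs) = - c (us @ y # x # vs))" (is "?P \<longleftrightarrow> ?Q")
  proof
    assume ?P
    show ?Q by (intro allI adj[OF \<open>?P\<close>])
  next
    assume ?Q
    show ?P by (intro allI impI alternating_permute spec[OF spec[OF spec[OF spec[OF \<open>?Q\<close>]]]])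
  qed
  show ?thesis
    unfolding chains_def mem_Collect_eq by (rule conj_cong[OF refl eq])
qed

lemma chainsD:
  assumes "c \<in> chains K j" "c xs \<noteq> 0"
  shows "distinct xs" "xs = [] \<or> set xs \<in> K" "int (length xs) = j + 1"
  using conjunct1[OF iffD1[OF chains_iff assms(1)], rule_format, OF assms(2)] by simp_all

lemma chains_swap:
  "c \<in> chains K j \<Longrightarrow> c (us @ x # y # vs) = - c (us @ y # x # vs)"
  using iffD1[OF chains_iff, THEN conjunct2, rule_format] .

lemma chains_move:
  assumes "c \<in> chains K j"
  shows "c (ws @ x # us @ vs) = (-1) ^ length us * c (ws @ us @ x # vs)"
proof (induction us arbitrary: ws)
  case Nil
  then show ?case by simp
next
  case (Cons u us)
  then show ?case
    using chains_swap[OF assms, of ws x u "us @ vs"] Cons[of "ws @ [u]"] by simp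
qed

lemma chainsI:
  assumes "\<And>xs. c xs \<noteq> 0 \<Longrightarrow> distinct xs \<and> (xs = [] \<or> set xs \<in> K) \<and> int (length xs) = j + 1"
    and "\<And>us x y vs. c (us @ x # y # vs) = - c (us @ y # x # vs)"
  shows "c \<in> chains K j"
  by (rule iffD2[OF chains_iff]) (intro conjI allI impI assms)

section \<open>Linear structure, restriction and splitting of chains\<close>

lemma chains_diff:
  assumes c: "c \<in> chains K j" and d: "d \<in> chains K j"
  shows "(\<lambda>xs. c xs - d xs) \<in> chains K j"
proof (rule chainsI)
  fix xs assume "c xs - d xs \<noteq> 0"
  then have "c xs \<noteq> 0 \<or> d xs \<noteq> 0" by auto
  then show "distinct xs \<and> (xs = [] \<or> set xs \<in> K) \<and> int (length xs) = j + 1"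
    using chainsD[OF c] chainsD[OF d] by blast
next
  fix us x y vs
  show "c (us @ x # y # vs) - d (us @ x # y # vs) = - (c (us @ y # x # vs) - d (us @ y # x # vs))"
    using chains_swap[OF c, of us x y vs] chains_swap[OF d, of us x y vs] by simp
qed

lemma chains_zero: "(\<lambda>_. 0) \<in> chains K j"
  by (rule chainsI) auto

lemma chains_uminus:
  assumes "c \<in> chains K j" shows "(\<lambda>xs. - c xs) \<in> chains K j"
  using chains_diff[OF chains_zero assms] by simp

lemma chains_add:
  assumes "c \<in> chains K j" "d \<in> chains K j"
  shows "(\<lambda>xs. c xs + d xs) \<in> chains K j"
  using chains_diff[OF assms(1) chains_uminus[OF assms(2)]] by simp

text \<open>\<open>P\<close> sees only the set of entries, so cutting off by \<open>P\<close>
  preserves the sign rule. Both inclusion into a larger complex and splitting over a union are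
  instances.\<close>

lemma chains_restrict:
  assumes c: "c \<in> chains K j" and "\<And>\<sigma>. \<sigma> \<in> K \<Longrightarrow> P \<sigma> \<Longrightarrow> \<sigma> \<in> L"
  shows "(\<lambda>xs. if P (set xs) then c xs else 0) \<in> chains L j"
proof (rule chainsI)
  fix xs assume "(if P (set xs) then c xs else 0) \<noteq> 0"
  then show "distinct xs \<and> (xs = [] \<or> set xs \<in> L) \<and> int (length xs) = j + 1"
    using chainsD[OF c, of xs] assms(2)[of "set xs"] by (auto split: if_splits)
next
  fix us x y vs
  show "(if P (set (us @ x # y # vs)) then c (us @ x # y # vs) else 0)
      = - (if P (set (us @ y # x # vs)) then c (us @ y # x # vs) else 0)"
    using chains_swap[OF c, of us x y vs] by (simp add: insert_commute)
qed

lemma chains_mono: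
  assumes "c \<in> chains K j" "K \<subseteq> L" shows "c \<in> chains L j"
  using chains_restrict[OF assms(1), of "\<lambda>_. True"] assms(2) by auto

lemma chains_Int:
  assumes "c \<in> chains A j" "c \<in> chains B j" shows "c \<in> chains (A \<inter> B) j"
  by (rule chainsI) (use chainsD[OF assms(1)] chainsD[OF assms(2)] chains_swap[OF assms(1)] in blast)+

lemma chains_split:
  assumes "c \<in> chains (A \<union> B) j"
  obtains a b where "a \<in> chains A j" "b \<in> chains B j" "c = (\<lambda>xs. a xs + b xs)"
proof
  show "(\<lambda>xs. if set xs \<in> A then c xs else 0) \<in> chains A j"
    by (rule chains_restrict[OF assms])
  show "(\<lambda>xs. if set xs \<notin> A then c xs else 0) \<in> chains B j"
    by (rule chains_restrict[OF assms]) auto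
qed auto

section \<open>The boundary operator and vanishing homology\<close>

lemma bdry_diff: "bdry K (\<lambda>xs. c xs - d xs) = (\<lambda>ys. bdry K c ys - bdry K d ys)"
  by (simp add: bdry_def sum_subtractf)

lemma bdry_add: "bdry K (\<lambda>xs. c xs + d xs) = (\<lambda>ys. bdry K c ys + bdry K d ys)"
  by (simp add: bdry_def sum.distrib)

lemma finite_vertices: "simplicial_complex K \<Longrightarrow> finite (\<Union>K)"
  by (auto simp: simplicial_complex_def)

text \<open>The complex enters \<open>bdry\<close> only as the range of summation, and a chain of
  \<open>L\<close> vanishes on every list with an entry that is not a vertex of
  \<open>L\<close>.\<close>

lemma bdry_subcomplex:
  assumes "c \<in> chains L j" "L \<subseteq> K" "simplicial_complex K"
  shows "bdry L c = bdry K c"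
proof
  fix ys
  have "c (v # ys) = 0" if "v \<notin> \<Union>L" for v
    using chainsD(2)[OF assms(1), of "v # ys"] that by auto
  then show "bdry L c ys = bdry K c ys"
    unfolding bdry_def using assms(2) finite_vertices[OF assms(3)]
    by (intro sum.mono_neutral_left) auto
qed

lemma bdry_chains:
  assumes K: "simplicial_complex K" and c: "c \<in> chains K (j + 1)"
  shows "bdry K c \<in> chains K j"
proof (rule chainsI)
  fix ys assume "bdry K c ys \<noteq> 0"
  then obtain v where "c (v # ys) \<noteq> 0"
    unfolding bdry_def by (rule sum.not_neutral_contains_not_neutral)
  from chainsD[OF c this] show "distinct ys \<and> (ys = [] \<or> set ys \<in> K) \<and> int (length ys) = j + 1"
    using K by (auto simp: simplicial_complex_def)
next
  fix us x y vs
  show "bdry K c (us @ x # y # vs) = - bdry K c (us @ y # x # vs)"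
    unfolding bdry_def sum_negf[symmetric]
    by (intro sum.cong refl chains_swap[OF c, of "_ # us" x y vs, unfolded append_Cons])
qed

text \<open>Exchanging the two summations swaps the two leading entries, so the double sum equals
  its own negative.\<close>

lemma bdry_bdry:
  assumes c: "c \<in> chains K j"
  shows "bdry K (bdry K c) = (\<lambda>_. 0)"
proof
  fix ys
  let ?S = "\<Sum>v\<in>\<Union>K. \<Sum>w\<in>\<Union>K. c (w # v # ys)"
  have "?S = (\<Sum>w\<in>\<Union>K. \<Sum>v\<in>\<Union>K. c (w # v # ys))"
    by (rule sum.swap)
  also have "\<dots> = (\<Sum>w\<in>\<Union>K. \<Sum>v\<in>\<Union>K. - c (v # w # ys))"
    by (intro sum.cong refl chains_swap[OF c, of "[]", unfolded append_Nil])
  also have "\<dots> = - ?S" by (simp add: sum_negf)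
  finally show "bdry K (bdry K c) ys = 0" by (simp add: bdry_def)
qed

lemma red_hom_vanishesE:
  assumes "red_hom_vanishes K j" "c \<in> chains K j" "bdry K c = (\<lambda>_. 0)"
  obtains d where "d \<in> chains K (j + 1)" "bdry K d = c"
  using assms unfolding red_hom_vanishes_def by blast

lemma red_hom_vanishesI:
  assumes "\<And>c. c \<in> chains K j \<Longrightarrow> bdry K c = (\<lambda>_. 0) \<Longrightarrow> \<exists>d\<in>chains K (j + 1). bdry K d = c"
  shows "red_hom_vanishes K j"
  using assms unfolding red_hom_vanishes_def by blast

lemma simplicial_complex_Un:
  "simplicial_complex A \<Longrightarrow> simplicial_complex B \<Longrightarrow> simplicial_complex (A \<union> B)"
  unfolding simplicial_complex_def by auto

lemma simplicial_complex_Int: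
  "simplicial_complex A \<Longrightarrow> simplicial_complex B \<Longrightarrow> simplicial_complex (A \<inter> B)"
  unfolding simplicial_complex_def by auto

subsection \<open>Mayer--Vietoris\<close>

context
  fixes A B :: "'a set set"
  assumes A: "simplicial_complex A" and B: "simplicial_complex B"
begin

text \<open>Lets one operator, the boundary in \<open>A \<union> B\<close>, serve for all the
  complexes in the Mayer--Vietoris arguments below.\<close>

lemma bdry_Un:
  "c \<in> chains A i \<Longrightarrow> bdry A c = bdry (A \<union> B) c"
  "c \<in> chains B i \<Longrightarrow> bdry B c = bdry (A \<union> B) c"
  "c \<in> chains (A \<inter> B) i \<Longrightarrow> bdry (A \<inter> B) c = bdry (A \<union> B) c"
  using simplicial_complex_Un[OF A B] by (auto intro: bdry_subcomplex)

lemma bdry_Un_chains: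
  "c \<in> chains A (i + 1) \<Longrightarrow> bdry (A \<union> B) c \<in> chains A i"
  "c \<in> chains B (i + 1) \<Longrightarrow> bdry (A \<union> B) c \<in> chains B i"
  using bdry_chains[OF A, of c i] bdry_chains[OF B, of c i] bdry_Un(1,2)[of c "i + 1"] by simp_all

text \<open>A cycle \<open>c\<close> bounds \<open>a\<close> in \<open>A\<close> and
  \<open>b\<close> in \<open>B\<close>, and \<open>a - b\<close> is a cycle of the union, hence the
  boundary of some \<open>wa + wb\<close>. Then \<open>a\<close> minus the boundary of
  \<open>wa\<close> equals \<open>b\<close> plus the boundary of \<open>wb\<close>; it lies in both
  complexes and still has boundary \<open>c\<close>.\<close>

lemma red_hom_vanishes_Int:
  assumes "red_hom_vanishes A j" "red_hom_vanishes B j" "red_hom_vanishes (A \<union> B) (j + 1)"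
  shows "red_hom_vanishes (A \<inter> B) j"
proof (rule red_hom_vanishesI)
  let ?D = "bdry (A \<union> B)"
  fix c assume c: "c \<in> chains (A \<inter> B) j" and "bdry (A \<inter> B) c = (\<lambda>_. 0)"
  then have cyc: "?D c = (\<lambda>_. 0)" by (simp add: bdry_Un)
  have cA: "c \<in> chains A j" and cB: "c \<in> chains B j" using c by (auto intro: chains_mono)
  obtain a where a: "a \<in> chains A (j + 1)" "?D a = c"
    using red_hom_vanishesE[OF assms(1) cA] cyc bdry_Un(1)[OF cA] bdry_Un(1)[of _ "j + 1"] by metis
  obtain b where b: "b \<in> chains B (j + 1)" "?D b = c"
    using red_hom_vanishesE[OF assms(2) cB] cyc bdry_Un(2)[OF cB] bdry_Un(2)[of _ "j + 1"] by metis
  have "(\<lambda>xs. a xs - b xs) \<in> chains (A \<union> B) (j + 1)"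
    using a b by (intro chains_diff) (auto intro: chains_mono)
  moreover have "?D (\<lambda>xs. a xs - b xs) = (\<lambda>_. 0)"
    using a b by (simp add: bdry_diff)
  ultimately obtain w where w: "w \<in> chains (A \<union> B) (j + 1 + 1)" "?D w = (\<lambda>xs. a xs - b xs)"
    by (rule red_hom_vanishesE[OF assms(3)])
  obtain wa wb where wa: "wa \<in> chains A (j + 1 + 1)" and wb: "wb \<in> chains B (j + 1 + 1)"
    and eq: "w = (\<lambda>xs. wa xs + wb xs)"
    using w(1) by (rule chains_split)
  define d where "d = (\<lambda>xs. a xs - ?D wa xs)"
  have d': "d = (\<lambda>xs. b xs + ?D wb xs)"
  proof
    fix xs
    show "d xs = b xs + ?D wb xs"
      using fun_cong[OF w(2), of xs] by (simp add: d_def eq bdry_add algebra_simps)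
  qed
  have "d \<in> chains A (j + 1)"
    unfolding d_def using a(1) bdry_Un_chains(1)[OF wa] by (rule chains_diff)
  moreover have "d \<in> chains B (j + 1)"
    unfolding d' using b(1) bdry_Un_chains(2)[OF wb] by (rule chains_add)
  ultimately have dI: "d \<in> chains (A \<inter> B) (j + 1)" by (rule chains_Int)
  have "?D (?D wa) = (\<lambda>_. 0)"
    by (rule bdry_bdry[OF chains_mono[OF wa]]) auto
  then have "?D d = c" using a by (simp add: d_def bdry_diff)
  then show "\<exists>d\<in>chains (A \<inter> B) (j + 1). bdry (A \<inter> B) d = c"
    using dI bdry_Un(3)[OF dI] by auto
qed

text \<open>If \<open>c\<close> bounds \<open>a + b\<close> in the union, the boundary of
  \<open>b\<close> is a cycle of the intersection. It bounds some \<open>e\<close> there, and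
  replacing \<open>b\<close> by \<open>e\<close> gives a filling inside \<open>A\<close>.\<close>

lemma red_hom_vanishes_left:
  assumes "red_hom_vanishes (A \<inter> B) j" "red_hom_vanishes (A \<union> B) j"
  shows "red_hom_vanishes A j"
proof (rule red_hom_vanishesI)
  let ?D = "bdry (A \<union> B)"
  fix c assume c: "c \<in> chains A j" and "bdry A c = (\<lambda>_. 0)"
  then have "?D c = (\<lambda>_. 0)" by (simp add: bdry_Un)
  moreover have "c \<in> chains (A \<union> B) j" using c by (auto intro: chains_mono)
  ultimately obtain d where d: "d \<in> chains (A \<union> B) (j + 1)" "?D d = c"
    using red_hom_vanishesE[OF assms(2)] by blast
  obtain a b where a: "a \<in> chains A (j + 1)" and b: "b \<in> chains B (j + 1)"
    and eq: "d = (\<lambda>xs. a xs + b xs)"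
    using d(1) by (rule chains_split)
  have Db: "?D b = (\<lambda>xs. c xs - ?D a xs)"
    using d(2) by (auto simp: eq bdry_add fun_eq_iff algebra_simps)
  have "?D b \<in> chains A j"
    unfolding Db using c bdry_Un_chains(1)[OF a] by (rule chains_diff)
  then have I: "?D b \<in> chains (A \<inter> B) j" using bdry_Un_chains(2)[OF b] by (rule chains_Int)
  have "?D (?D b) = (\<lambda>_. 0)"
    by (rule bdry_bdry[OF chains_mono[OF b]]) auto
  then have "bdry (A \<inter> B) (?D b) = (\<lambda>_. 0)" unfolding bdry_Un(3)[OF I] .
  then obtain e where e: "e \<in> chains (A \<inter> B) (j + 1)" and "bdry (A \<inter> B) e = ?D b"
    by (rule red_hom_vanishesE[OF assms(1) I])
  then have De: "?D e = ?D b" using bdry_Un(3)[OF e] by simp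
  have "(\<lambda>xs. a xs + e xs) \<in> chains A (j + 1)"
    using a e by (intro chains_add) (auto intro: chains_mono)
  moreover from this have "bdry A (\<lambda>xs. a xs + e xs) = ?D (\<lambda>xs. a xs + e xs)"
    by (rule bdry_Un(1))
  then have "bdry A (\<lambda>xs. a xs + e xs) = c"
    by (simp only: bdry_add De Db) simp
  ultimately show "\<exists>d\<in>chains A (j + 1). bdry A d = c" by blast
qed

text \<open>Split a cycle as \<open>a + b\<close>. The boundaries of \<open>a\<close> and
  \<open>b\<close> cancel, so they lie in the intersection, one degree lower; a filling
  \<open>e\<close> there corrects the parts to cycles \<open>a - e\<close> of \<open>A\<close> and
  \<open>b + e\<close> of \<open>B\<close>.\<close>

lemma red_hom_vanishes_Un:
  assumes "red_hom_vanishes A j" "red_hom_vanishes B j" "red_hom_vanishes (A \<inter> B) (j - 1)"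
  shows "red_hom_vanishes (A \<union> B) j"
proof (rule red_hom_vanishesI)
  let ?D = "bdry (A \<union> B)"
  fix c assume c: "c \<in> chains (A \<union> B) j" and cyc: "?D c = (\<lambda>_. 0)"
  obtain a b where a: "a \<in> chains A j" and b: "b \<in> chains B j"
    and eq: "c = (\<lambda>xs. a xs + b xs)"
    using c by (rule chains_split)
  have Da: "?D a = (\<lambda>xs. - ?D b xs)"
    using cyc by (simp add: eq bdry_add fun_eq_iff eq_neg_iff_add_eq_0)
  have "?D a \<in> chains A (j - 1)" "?D b \<in> chains B (j - 1)"
    using bdry_Un_chains[of _ "j - 1"] a b by auto
  then have I: "?D a \<in> chains (A \<inter> B) (j - 1)"
    unfolding Da by (auto intro: chains_Int chains_uminus)
  have "?D (?D a) = (\<lambda>_. 0)"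
    by (rule bdry_bdry[OF chains_mono[OF a]]) auto
  then have "bdry (A \<inter> B) (?D a) = (\<lambda>_. 0)" unfolding bdry_Un(3)[OF I] .
  then obtain e where "e \<in> chains (A \<inter> B) (j - 1 + 1)" and *: "bdry (A \<inter> B) e = ?D a"
    by (rule red_hom_vanishesE[OF assms(3) I])
  then have e: "e \<in> chains (A \<inter> B) j" by simp
  then have De: "?D e = ?D a" using bdry_Un(3)[OF e] * by simp
  have eA: "e \<in> chains A j" and eB: "e \<in> chains B j" using e by (auto intro: chains_mono)
  have a': "(\<lambda>xs. a xs - e xs) \<in> chains A j" and b': "(\<lambda>xs. b xs + e xs) \<in> chains B j"
    using chains_diff[OF a eA] chains_add[OF b eB] .
  have "?D (\<lambda>xs. a xs - e xs) = (\<lambda>_. 0)" "?D (\<lambda>xs. b xs + e xs) = (\<lambda>_. 0)"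
    unfolding bdry_diff bdry_add De Da by simp_all
  then have A0: "bdry A (\<lambda>xs. a xs - e xs) = (\<lambda>_. 0)"
    and B0: "bdry B (\<lambda>xs. b xs + e xs) = (\<lambda>_. 0)"
    by (simp_all only: bdry_Un(1)[OF a'] bdry_Un(2)[OF b'])
  obtain f where f: "f \<in> chains A (j + 1)" "bdry A f = (\<lambda>xs. a xs - e xs)"
    using assms(1) a' A0 by (rule red_hom_vanishesE)
  obtain g where g: "g \<in> chains B (j + 1)" "bdry B g = (\<lambda>xs. b xs + e xs)"
    using assms(2) b' B0 by (rule red_hom_vanishesE)
  have "(\<lambda>xs. f xs + g xs) \<in> chains (A \<union> B) (j + 1)"
    using f g by (intro chains_add) (auto intro: chains_mono)
  moreover have "?D (\<lambda>xs. f xs + g xs) = c"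
    using f(2) g(2) bdry_Un(1)[OF f(1)] bdry_Un(2)[OF g(1)] by (simp add: bdry_add eq)
  ultimately show "\<exists>d\<in>chains (A \<union> B) (j + 1). ?D d = c" by blast
qed

end

subsection \<open>Cones and removal of open stars\<close>

text \<open>The cone with apex \<open>p\<close> over a cycle has that cycle as its boundary. Since
  \<open>{} \<in> K\<close>, the apex is itself a vertex, so degree -1 is covered as well.\<close>

lemma red_hom_vanishes_cone:
  assumes K: "simplicial_complex K" and "{} \<in> K" and cone: "\<And>\<rho>. \<rho> \<in> K \<Longrightarrow> insert p \<rho> \<in> K"
  shows "red_hom_vanishes K j"
proof (rule red_hom_vanishesI)
  fix c assume c: "c \<in> chains K j" and cyc: "bdry K c = (\<lambda>_. 0)"
  \<comment> \<open>The cone over \<open>c\<close>: delete \<open>p\<close> and evaluate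
    \<open>c\<close>, with the sign of moving \<open>p\<close> to the front.\<close>
  define d where "d xs = (if distinct xs \<and> p \<in> set xs
    then (-1) ^ length (takeWhile (\<lambda>x. x \<noteq> p) xs) * c (remove1 p xs) else 0)" for xs
  have d_app: "d (us @ p # vs) = (-1) ^ length us * c (us @ vs)" if "distinct (us @ p # vs)" for us vs
  proof -
    have "takeWhile (\<lambda>x. x \<noteq> p) (us @ p # vs) = us" using that by (subst takeWhile_append2) auto
    then show ?thesis using that by (simp add: d_def remove1_append)
  qed
  have "d \<in> chains K (j + 1)"
  proof (rule chainsI)
    fix xs assume nz: "d xs \<noteq> 0"
    then have dist: "distinct xs" and p: "p \<in> set xs" by (auto simp: d_def split: if_splits)
    then have "c (remove1 p xs) \<noteq> 0" using nz by (simp add: d_def)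
    then have rm: "set (remove1 p xs) \<in> K" "int (length (remove1 p xs)) = j + 1"
      using chainsD(2,3)[OF c, of "remove1 p xs"] \<open>{} \<in> K\<close> by (metis empty_set)+
    have "insert p (set (remove1 p xs)) = set xs" using dist p by auto
    then have "set xs \<in> K" using cone[OF rm(1)] by simp
    moreover have "int (length xs) = j + 1 + 1"
      using rm(2) p length_pos_if_in_set[OF p] by (simp add: length_remove1)
    ultimately show "distinct xs \<and> (xs = [] \<or> set xs \<in> K) \<and> int (length xs) = j + 1 + 1"
      using dist by simp
  next
    fix us x y vs
    show "d (us @ x # y # vs) = - d (us @ y # x # vs)"
    proof (cases "distinct (us @ x # y # vs) \<and> p \<in> set (us @ x # y # vs)")
      case False
      then have "d (us @ x # y # vs) = 0" "d (us @ y # x # vs) = 0"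
        unfolding d_def by auto
      then show ?thesis by simp
    next
      case True
      then have dist: "distinct (us @ x # y # vs)" "distinct (us @ y # x # vs)" by auto
      \<comment> \<open>If \<open>p\<close> is one of the swapped entries, its position shifts by
        one and the power of -1 changes sign. Otherwise that power stays and the sign comes from
        \<open>c\<close>.\<close>
      consider "x = p" | "y = p" | "p \<in> set us" | "p \<in> set vs" using True by auto
      then show ?thesis
      proof cases
        case 1
        then show ?thesis using dist d_app[of us "y # vs"] d_app[of "us @ [y]" vs] by simp
      next
        case 2
        then show ?thesis using dist d_app[of us "x # vs"] d_app[of "us @ [x]" vs] by simp
      next
        case 3
        then obtain us1 us2 where "us = us1 @ p # us2" by (meson split_list)
        then show ?thesis
          using dist d_app[of us1 "us2 @ x # y # vs"] d_app[of us1 "us2 @ y # x # vs"]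
            chains_swap[OF c, of "us1 @ us2" x y vs] by simp
      next
        case 4
        then obtain vs1 vs2 where "vs = vs1 @ p # vs2" by (meson split_list)
        then show ?thesis
          using dist d_app[of "us @ x # y # vs1" vs2] d_app[of "us @ y # x # vs1" vs2]
            chains_swap[OF c, of us x y "vs1 @ vs2"] by simp
      qed
    qed
  qed
  moreover have "bdry K d = c"
  proof
    fix ys
    have fin: "finite (\<Union>K)" using K by (rule finite_vertices)
    have pK: "p \<in> \<Union>K" using cone[OF \<open>{} \<in> K\<close>] by auto
    \<comment> \<open>The apex term is isolated: it is the only contribution when \<open>p\<close>
      does not occur in \<open>ys\<close>, and it vanishes when \<open>p\<close> occurs.\<close>
    have split: "bdry K h zs = h (p # zs) + (\<Sum>v\<in>\<Union>K - {p}. h (v # zs))" for h zs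
      unfolding bdry_def by (rule sum.remove[OF fin pK])
    show "bdry K d ys = c ys"
    proof (cases "distinct ys")
      case False
      then have "d (v # ys) = 0" for v by (simp add: d_def)
      moreover have "c ys = 0" using chainsD(1)[OF c] False by blast
      ultimately show ?thesis by (simp add: bdry_def)
    next
      case dist: True
      show ?thesis
      proof (cases "p \<in> set ys")
        case False
        then have "d (v # ys) = 0" if "v \<noteq> p" for v using that by (auto simp: d_def)
        moreover have "d (p # ys) = c ys" using d_app[of "[]" ys] dist False by simp
        ultimately show ?thesis by (simp add: split)
      next
        case True
        then obtain us vs where ys: "ys = us @ p # vs" by (meson split_list)
        have "d (v # ys) = - ((-1) ^ length us * c (v # us @ vs))" if "v \<noteq> p" for v
        proof (cases "v \<in> set ys")
          case True
          then have "d (v # ys) = 0" by (simp add: d_def)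
          moreover have "\<not> distinct (v # us @ vs)" using True that ys by auto
          then have "c (v # us @ vs) = 0" using chainsD(1)[OF c] by blast
          ultimately show ?thesis by simp
        next
          case False
          then show ?thesis using d_app[of "v # us" vs] dist ys that by simp
        qed
        then have "(\<Sum>v\<in>\<Union>K - {p}. d (v # ys))
            = - ((-1) ^ length us * (\<Sum>v\<in>\<Union>K - {p}. c (v # us @ vs)))"
          by (simp add: sum_distrib_left sum_negf)
        \<comment> \<open>Here the cycle condition enters, at the list \<open>ys\<close> without
          \<open>p\<close>.\<close>
        moreover have "(\<Sum>v\<in>\<Union>K - {p}. c (v # us @ vs)) = - c (p # us @ vs)"
          using split[of c "us @ vs"] cyc by simp
        moreover have "c (p # us @ vs) = (-1) ^ length us * c ys"
          using chains_move[OF c, of "[]" p us vs] ys by simp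
        moreover have "d (p # ys) = 0" using True by (simp add: d_def)
        ultimately show ?thesis
          by (simp add: split flip: mult.assoc power_add mult_2)
      qed
    qed
  qed
  ultimately show "\<exists>d\<in>chains K (j + 1). bdry K d = c" by blast
qed

text \<open>The open star of \<open>\<tau>\<close> is removed by Mayer--Vietoris: the closed star and its intersection
  with what remains are both cones with apex \<open>p\<close>.\<close>
lemma red_hom_vanishes_remove_simplex:
  assumes Z: "simplicial_complex Z" and "\<tau> \<in> Z" "\<tau> \<noteq> {}" "p \<notin> \<tau>"
    and cone: "\<And>\<rho>. \<rho> \<in> Z \<Longrightarrow> \<tau> \<subseteq> \<rho> \<Longrightarrow> insert p \<rho> \<in> Z"
  shows "red_hom_vanishes Z j \<longleftrightarrow> red_hom_vanishes {\<rho> \<in> Z. \<not> \<tau> \<subseteq> \<rho>} j"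
proof -
  let ?A = "{\<rho> \<in> Z. \<not> \<tau> \<subseteq> \<rho>}" and ?B = "{\<rho> \<in> Z. \<rho> \<union> \<tau> \<in> Z}"
  have down: "\<sigma> \<in> Z" if "\<rho> \<in> Z" "\<sigma> \<subseteq> \<rho>" for \<sigma> \<rho>
    using Z that unfolding simplicial_complex_def by blast
  have A: "simplicial_complex ?A"
    using Z unfolding simplicial_complex_def by fastforce
  have B: "simplicial_complex ?B"
    using Z unfolding simplicial_complex_def
    by (auto intro: down)
  have Un: "?A \<union> ?B = Z" by (auto simp: Un_absorb2)
  have insB: "insert p \<rho> \<in> Z \<and> insert p \<rho> \<union> \<tau> \<in> Z" if "\<rho> \<union> \<tau> \<in> Z" for \<rho>
    using cone[OF that] down[of "insert p (\<rho> \<union> \<tau>)" "insert p \<rho>"] by auto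
  have vB: "red_hom_vanishes ?B i" for i
    using assms(2) down by (intro red_hom_vanishes_cone[OF B, of p]) (auto dest: insB)
  \<comment> \<open>Adding \<open>p\<close> cannot complete a copy of \<open>\<tau>\<close> because
    \<open>p \<notin> \<tau>\<close>; the empty simplex stays in \<open>?A\<close> because
    \<open>\<tau> \<noteq> {}\<close>.\<close>
  have vI: "red_hom_vanishes (?A \<inter> ?B) i" for i
    using assms(2-4) down
    by (intro red_hom_vanishes_cone[OF simplicial_complex_Int[OF A B], of p]) (auto dest: insB)
  show ?thesis
    using red_hom_vanishes_left[OF A B vI] red_hom_vanishes_Un[OF A B _ vB vI] unfolding Un by blast
qed

subsection \<open>From unions to intersections\<close>

text \<open>The shift by 2 in \<open>eta_H\<close> turns a bound \<open>N\<close> into vanishing up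
  to degree \<open>N - 2\<close>; for \<open>N = 0\<close> this range is empty.\<close>

lemma enat_le_eta_H_iff:
  "enat N \<le> eta_H K \<longleftrightarrow> (\<forall>j. -1 \<le> j \<and> j \<le> int N - 2 \<longrightarrow> red_hom_vanishes K j)"
proof
  assume le: "enat N \<le> eta_H K"
  show "\<forall>j. -1 \<le> j \<and> j \<le> int N - 2 \<longrightarrow> red_hom_vanishes K j"
  proof (rule ccontr)
    assume "\<not> (\<forall>j. -1 \<le> j \<and> j \<le> int N - 2 \<longrightarrow> red_hom_vanishes K j)"
    then obtain j where j: "-1 \<le> j" "j \<le> int N - 2" "\<not> red_hom_vanishes K j" by blast
    \<comment> \<open>A failure in degree \<open>j\<close> forces \<open>k < j\<close> for each
      admissible \<open>k\<close>, so \<open>k + 2 \<le> j + 1 \<le> N - 1\<close>.\<close>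
    have "eta_H K \<le> enat (N - 1)"
      unfolding eta_H_def
    proof (rule Sup_least, clarify)
      fix k assume "\<forall>i. - 1 \<le> i \<and> i \<le> k \<longrightarrow> red_hom_vanishes K i"
      then have "k < j" using j by force
      then show "enat (nat (k + 2)) \<le> enat (N - 1)" using j by auto
    qed
    also have "\<dots> < enat N" using j by auto
    finally show False using le by simp
  qed
next
  assume *: "\<forall>j. -1 \<le> j \<and> j \<le> int N - 2 \<longrightarrow> red_hom_vanishes K j"
  show "enat N \<le> eta_H K"
    unfolding eta_H_def
    by (rule Sup_upper) (use * in \<open>auto intro!: exI[of _ "int N - 2"]\<close>)
qed

text \<open>Degree \<open>j\<close> of the intersection is controlled by degree \<open>j + 1\<close>
  of the union, hence the larger bound demanded there.\<close>

lemma eta_H_Int: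
  assumes "simplicial_complex A" "simplicial_complex B"
    and "enat N \<le> eta_H A" "enat N \<le> eta_H B" "enat (Suc N) \<le> eta_H (A \<union> B)"
  shows "enat N \<le> eta_H (A \<inter> B)"
  using assms(3-) unfolding enat_le_eta_H_iff
  by (auto intro!: red_hom_vanishes_Int[OF assms(1,2)])

lemma simplicial_complex_UN:
  "finite T \<Longrightarrow> (\<And>i. i \<in> T \<Longrightarrow> simplicial_complex (K i)) \<Longrightarrow> simplicial_complex (\<Union>i\<in>T. K i)"
  unfolding simplicial_complex_def by (simp add: Ball_def) blast

lemma simplicial_complex_INT:
  assumes "finite S" "S \<noteq> {}" "\<And>i. i \<in> S \<Longrightarrow> simplicial_complex (K i)"
  shows "simplicial_complex (\<Inter>i\<in>S. K i)"
  using assms by (induction S rule: finite_ne_induct) (auto intro: simplicial_complex_Int)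

text \<open>Splitting off one member of \<open>S\<close> writes the complex as an intersection of two complexes of
  the same form, whose union again has this form, with that member moved into \<open>T\<close>.\<close>
lemma eta_H_INT_Un_UN:
  fixes K :: "'i \<Rightarrow> 'b set set"
  assumes "finite S" "S \<noteq> {}" "finite T" "S \<inter> T = {}" "S \<union> T \<subseteq> I"
    and sc: "\<And>i. i \<in> I \<Longrightarrow> simplicial_complex (K i)"
    and eta: "\<And>J. finite J \<Longrightarrow> J \<subseteq> I \<Longrightarrow> J \<noteq> {} \<Longrightarrow> enat (card J + m) \<le> eta_H (\<Union>i\<in>J. K i)"
  shows "enat (card T + m + 1) \<le> eta_H ((\<Inter>i\<in>S. K i) \<union> (\<Union>i\<in>T. K i))"
  using assms(1-5)
proof (induction S arbitrary: T rule: finite_ne_induct)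
  case (singleton s)
  then have "enat (card (insert s T) + m) \<le> eta_H (\<Union>i\<in>insert s T. K i)"
    by (intro eta) auto
  then show ?case using singleton by simp
next
  case (insert s F)
  let ?U = "\<Union>i\<in>T. K i"
  let ?A = "K s \<union> ?U" and ?B = "(\<Inter>i\<in>F. K i) \<union> ?U"
  have U: "simplicial_complex ?U"
    using insert.prems sc by (intro simplicial_complex_UN) auto
  have A: "simplicial_complex ?A"
    using insert.prems sc U by (intro simplicial_complex_Un) auto
  have B: "simplicial_complex ?B"
    using insert.prems insert.hyps sc U
    by (intro simplicial_complex_Un simplicial_complex_INT) auto
  have "enat (card (insert s T) + m) \<le> eta_H (\<Union>i\<in>insert s T. K i)"
    using insert.prems by (intro eta) auto
  then have "enat (card T + m + 1) \<le> eta_H ?A" using insert.prems by simp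
  moreover have "enat (card T + m + 1) \<le> eta_H ?B"
    using insert.prems by (intro insert.IH) auto
  \<comment> \<open>Moving \<open>s\<close> into \<open>T\<close> raises the cardinality by one,
    which supplies the surplus that \<open>eta_H_Int\<close> asks of the union.\<close>
  moreover have "enat (card (insert s T) + m + 1)
      \<le> eta_H ((\<Inter>i\<in>F. K i) \<union> (\<Union>i\<in>insert s T. K i))"
    using insert.prems insert.hyps by (intro insert.IH) auto
  then have "enat (Suc (card T + m + 1)) \<le> eta_H (?A \<union> ?B)"
    using insert.prems by (simp add: Un_ac)
  ultimately have "enat (card T + m + 1) \<le> eta_H (?A \<inter> ?B)"
    by (rule eta_H_Int[OF A B])
  moreover have "?A \<inter> ?B = (\<Inter>i\<in>insert s F. K i) \<union> ?U" by auto
  ultimately show ?case by simp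
qed

subsection \<open>Relabelling of vertices\<close>

lemma chains_pullback:
  assumes "inj f" "c \<in> chains ((`) f ` K) j"
  shows "(\<lambda>xs. c (map f xs)) \<in> chains K j"
proof (rule chainsI)
  fix xs assume "c (map f xs) \<noteq> 0"
  from chainsD[OF assms(2) this]
  show "distinct xs \<and> (xs = [] \<or> set xs \<in> K) \<and> int (length xs) = j + 1"
    using assms(1) by (auto simp: distinct_map inj_image_eq_iff)
next
  fix us x y vs
  show "c (map f (us @ x # y # vs)) = - c (map f (us @ y # x # vs))"
    using chains_swap[OF assms(2), of "map f us" "f x" "f y" "map f vs"] by simp
qed

lemma bdry_image:
  assumes "inj f"
  shows "bdry K (\<lambda>xs. c (map f xs)) ys = bdry ((`) f ` K) c (map f ys)"
proof -
  have "\<Union>((`) f ` K) = f ` \<Union>K" by auto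
  then show ?thesis
    using assms by (simp add: bdry_def sum.reindex inj_on_subset)
qed

lemma chains_eq_0_outside_range:
  assumes "c \<in> chains ((`) f ` K) j" "\<not> set xs \<subseteq> range f"
  shows "c xs = 0"
  using chainsD(2)[OF assms(1), of xs] assms(2) by auto

lemma chains_pushforward:
  assumes f: "inj f" and c: "c \<in> chains K j"
  obtains c' where "c' \<in> chains ((`) f ` K) j" "c = (\<lambda>xs. c' (map f xs))"
proof
  \<comment> \<open>Lists leaving the range of \<open>f\<close> span no simplex of the image, so the
    value there has to be 0.\<close>
  define c' where "c' xs = (if set xs \<subseteq> range f then c (map (inv f) xs) else 0)" for xs
  show "c' \<in> chains ((`) f ` K) j"
  proof (rule chainsI)
    fix xs assume nz: "c' xs \<noteq> 0"
    then have "set xs \<subseteq> range f" by (auto simp: c'_def split: if_splits)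
    then obtain zs where xs: "xs = map f zs" by (metis ex_map_conv image_iff rangeI subset_iff)
    then have "c zs \<noteq> 0" using nz f by (auto simp: c'_def split: if_splits)
    from chainsD[OF c this]
    show "distinct xs \<and> (xs = [] \<or> set xs \<in> (`) f ` K) \<and> int (length xs) = j + 1"
      using f xs by (auto simp: distinct_map intro: inj_on_subset)
  next
    fix us x y vs
    show "c' (us @ x # y # vs) = - c' (us @ y # x # vs)"
      using chains_swap[OF c, of "map (inv f) us" "inv f x" "inv f y" "map (inv f) vs"]
      by (auto simp: c'_def)
  qed
  show "c = (\<lambda>xs. c' (map f xs))"
    using f by (auto simp: c'_def fun_eq_iff o_def)
qed

lemma simplicial_complex_image:
  assumes "simplicial_complex K"
  shows "simplicial_complex ((`) f ` K)"
  using assms unfolding simplicial_complex_def by (auto simp: subset_image_iff)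

text \<open>Pullback and pushforward match chains and commute with boundaries. This is used to pass
  to and from a complex on a sum type along \<open>Inl\<close> and \<open>Inr\<close>.\<close>

lemma red_hom_vanishes_image:
  assumes f: "inj f" and K: "simplicial_complex K"
  shows "red_hom_vanishes ((`) f ` K) j \<longleftrightarrow> red_hom_vanishes K j"
proof
  let ?fK = "(`) f ` K"
  have eq: "c = c'" if "c \<in> chains ?fK i" "c' \<in> chains ?fK i" "\<And>xs. c (map f xs) = c' (map f xs)"
    for c c' i
  proof
    fix xs
    show "c xs = c' xs"
    proof (cases "set xs \<subseteq> range f")
      case True
      then obtain zs where "xs = map f zs" by (metis ex_map_conv image_iff rangeI subset_iff)
      then show ?thesis using that(3) by simp
    next
      case False
      then show ?thesis
        using chains_eq_0_outside_range[OF that(1)] chains_eq_0_outside_range[OF that(2)] by simp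
    qed
  qed
  have fK: "simplicial_complex ?fK" using K by (rule simplicial_complex_image)
  {
    assume v: "red_hom_vanishes ?fK j"
    show "red_hom_vanishes K j"
    proof (rule red_hom_vanishesI)
      fix c assume "c \<in> chains K j" and cyc: "bdry K c = (\<lambda>_. 0)"
      then obtain c' where c': "c' \<in> chains ?fK j" "c = (\<lambda>xs. c' (map f xs))"
        using chains_pushforward[OF f] by metis
      have "bdry ?fK c' = (\<lambda>_. 0)"
      proof (rule eq[of _ "j - 1"])
        show "bdry ?fK c' \<in> chains ?fK (j - 1)" using c' by (intro bdry_chains[OF fK]) simp
        show "bdry ?fK c' (map f xs) = 0" for xs
          using cyc by (simp add: c' bdry_image[OF f, symmetric])
      qed (rule chains_zero)
      then obtain d where d: "d \<in> chains ?fK (j + 1)" "bdry ?fK d = c'"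
        by (rule red_hom_vanishesE[OF v c'(1)])
      then have "bdry K (\<lambda>xs. d (map f xs)) = c"
        by (simp add: fun_eq_iff bdry_image[OF f] c')
      then show "\<exists>d\<in>chains K (j + 1). bdry K d = c"
        using chains_pullback[OF f d(1)] by blast
    qed
  next
    assume v: "red_hom_vanishes K j"
    show "red_hom_vanishes ?fK j"
    proof (rule red_hom_vanishesI)
      fix c assume c: "c \<in> chains ?fK j" and cyc: "bdry ?fK c = (\<lambda>_. 0)"
      have "bdry K (\<lambda>xs. c (map f xs)) = (\<lambda>_. 0)"
        by (simp add: fun_eq_iff bdry_image[OF f] cyc)
      then obtain d where d: "d \<in> chains K (j + 1)" "bdry K d = (\<lambda>xs. c (map f xs))"
        by (rule red_hom_vanishesE[OF v chains_pullback[OF f c]])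
      obtain d' where d': "d' \<in> chains ?fK (j + 1)" "d = (\<lambda>xs. d' (map f xs))"
        using chains_pushforward[OF f d(1)] .
      have "bdry ?fK d' = c"
      proof (rule eq[of _ j])
        show "bdry ?fK d' \<in> chains ?fK j" using d'(1) by (rule bdry_chains[OF fK])
        show "bdry ?fK d' (map f xs) = c (map f xs)" for xs
          using fun_cong[OF d(2), of xs] by (simp add: d' bdry_image[OF f])
      qed (rule c)
      then show "\<exists>d\<in>chains ?fK (j + 1). bdry ?fK d = c" using d'(1) by blast
    qed
  }
qed

subsection \<open>Order complexes\<close>

definition order_complex :: "'b set set \<Rightarrow> 'b set set set" where
  "order_complex U = {S. S \<subseteq> U \<and> (\<forall>a\<in>S. \<forall>b\<in>S. a \<subseteq> b \<or> b \<subseteq> a)}"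

lemma simplicial_complexI:
  assumes "finite X" "K \<subseteq> Pow X" "\<And>\<sigma> \<tau>. \<sigma> \<in> K \<Longrightarrow> \<tau> \<subseteq> \<sigma> \<Longrightarrow> \<tau> \<in> K"
  shows "simplicial_complex K"
  unfolding simplicial_complex_def
proof (intro conjI ballI allI impI)
  show "finite K" using assms(1,2) by (simp add: finite_subset)
  show "finite \<sigma>" if "\<sigma> \<in> K" for \<sigma>
    using assms(1,2) that by (meson PowD finite_subset subsetD)
qed (use assms(3) in blast)

lemma simplicial_complex_order_complex:
  assumes "finite U" shows "simplicial_complex (order_complex U)"
proof (rule simplicial_complexI[OF assms])
  show "T \<in> order_complex U" if "S \<in> order_complex U" "T \<subseteq> S" for S T
    using that unfolding order_complex_def by blast
qed (auto simp: order_complex_def)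

text \<open>A complex containing both \<open>M\<close> and the order complex of \<open>U\<close>. Removing the
  vertices \<open>Inr \<sigma>\<close>, smallest \<open>\<sigma>\<close> first, leaves \<open>M\<close>; removing the simplices \<open>Inl ` \<tau>\<close>, largest \<open>\<tau>\<close>
  first, leaves the order complex. No step changes the homology.\<close>
definition joint :: "'a set set \<Rightarrow> 'a set set \<Rightarrow> ('a + 'a set) set set" where
  "joint M U = {\<rho>. Inl -` \<rho> \<in> M \<and> Inr -` \<rho> \<in> order_complex U \<and> (\<forall>\<sigma>\<in>Inr -` \<rho>. Inl -` \<rho> \<subseteq> \<sigma>)}"

lemma vimage_sum_image [simp]:
  "Inl -` (Inl ` A) = A" "Inr -` (Inr ` B) = B" "Inl -` (Inr ` B) = {}" "Inr -` (Inl ` A) = {}"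
  by auto

lemma sum_set_eqI:
  assumes "Inl -` A = Inl -` B" "Inr -` A = Inr -` B" shows "A = B"
proof (rule set_eqI)
  show "x \<in> A \<longleftrightarrow> x \<in> B" for x using assms by (cases x) (auto simp: set_eq_iff)
qed

lemma simplicial_complex_joint:
  assumes M: "simplicial_complex M" and U: "finite U"
  shows "simplicial_complex (joint M U)"
proof (rule simplicial_complexI)
  show "finite (Inl ` \<Union>M \<union> Inr ` U)" using U finite_vertices[OF M] by simp
  show "joint M U \<subseteq> Pow (Inl ` \<Union>M \<union> Inr ` U)"
  proof (rule subsetI, rule PowI, rule subsetI)
    fix \<rho> x assume "\<rho> \<in> joint M U" and x: "x \<in> \<rho>"
    then have "Inl -` \<rho> \<in> M" "Inr -` \<rho> \<subseteq> U" by (simp_all add: joint_def order_complex_def)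
    then show "x \<in> Inl ` \<Union>M \<union> Inr ` U"
      using x by (cases x) blast+
  qed
next
  fix \<rho> \<rho>' assume \<rho>: "\<rho> \<in> joint M U" and "\<rho>' \<subseteq> \<rho>"
  then have sub: "Inl -` \<rho>' \<subseteq> Inl -` \<rho>" "Inr -` \<rho>' \<subseteq> Inr -` \<rho>" by auto
  then have "Inl -` \<rho>' \<in> M" "Inr -` \<rho>' \<in> order_complex U"
    using \<rho> M simplicial_complex_order_complex[OF U]
    unfolding joint_def simplicial_complex_def by blast+
  then show "\<rho>' \<in> joint M U" using \<rho> sub unfolding joint_def by blast
qed

text \<open>In a simplex containing \<open>Inr \<sigma>\<close> with \<open>\<sigma>\<close>
  minimal, the part in \<open>M\<close> lies inside \<open>\<sigma>\<close>. The assumed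
  \<open>w\<close> can therefore be added, and \<open>Inl w\<close> is the apex for removing
  \<open>Inr \<sigma>\<close>.\<close>

lemma red_hom_vanishes_joint_left:
  assumes M: "simplicial_complex M" "{} \<in> M" and "finite U"
    and "\<And>\<sigma>. \<sigma> \<in> U \<Longrightarrow> \<exists>w. \<forall>\<tau>\<in>M. \<tau> \<subseteq> \<sigma> \<longrightarrow> insert w \<tau> \<in> M \<and> w \<in> \<sigma>"
  shows "red_hom_vanishes (joint M U) j \<longleftrightarrow> red_hom_vanishes (joint M {}) j"
  using assms(3,4)
proof (induction U rule: finite_psubset_induct)
  case (psubset U)
  show ?case
  proof (cases "U = {}")
    case False
    then obtain \<sigma> where \<sigma>: "\<sigma> \<in> U" "\<And>\<sigma>'. \<sigma>' \<in> U \<Longrightarrow> \<sigma>' \<subseteq> \<sigma> \<Longrightarrow> \<sigma>' = \<sigma>"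
      using finite_has_minimal[OF psubset.hyps(1)] by metis
    obtain w where w: "\<And>\<tau>. \<tau> \<in> M \<Longrightarrow> \<tau> \<subseteq> \<sigma> \<Longrightarrow> insert w \<tau> \<in> M \<and> w \<in> \<sigma>"
      using psubset.prems[OF \<sigma>(1)] by blast
    have "red_hom_vanishes (joint M U) j
        \<longleftrightarrow> red_hom_vanishes {\<rho> \<in> joint M U. \<not> {Inr \<sigma>} \<subseteq> \<rho>} j"
    proof (rule red_hom_vanishes_remove_simplex)
      show "simplicial_complex (joint M U)"
        using M(1) psubset.hyps by (rule simplicial_complex_joint)
      have "Inl -` {Inr \<sigma> :: 'a + 'a set} = {}" "Inr -` {Inr \<sigma> :: 'a + 'a set} = {\<sigma>}" by auto
      then show "{Inr \<sigma>} \<in> joint M U"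
        using M(2) \<sigma>(1) by (simp add: joint_def order_complex_def)
      show "Inl w \<notin> {Inr \<sigma>}" by simp
    next
      fix \<rho> assume \<rho>: "\<rho> \<in> joint M U" "{Inr \<sigma>} \<subseteq> \<rho>"
      have vim: "Inl -` insert (Inl w) \<rho> = insert w (Inl -` \<rho>)" "Inr -` insert (Inl w) \<rho> = Inr -` \<rho>"
        by auto
      have "\<sigma> \<in> Inr -` \<rho>" using \<rho>(2) by auto
      \<comment> \<open>By minimality \<open>\<sigma>\<close> is the least member of the chain, so a
        vertex \<open>w\<close> of \<open>\<sigma>\<close> lies in all members.\<close>
      then have "Inl -` \<rho> \<subseteq> \<sigma>" "\<sigma> \<subseteq> \<sigma>'" if "\<sigma>' \<in> Inr -` \<rho>" for \<sigma>'
        using \<rho>(1) \<sigma>(2)[of \<sigma>'] that by (auto simp: joint_def order_complex_def)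
      then show "insert (Inl w) \<rho> \<in> joint M U"
        using w[of "Inl -` \<rho>"] \<rho>(1) \<open>\<sigma> \<in> Inr -` \<rho>\<close> unfolding joint_def mem_Collect_eq vim by blast
    qed simp
    also have "{\<rho> \<in> joint M U. \<not> {Inr \<sigma>} \<subseteq> \<rho>} = joint M (U - {\<sigma>})"
      by (auto simp: joint_def order_complex_def)
    also have "red_hom_vanishes \<dots> j \<longleftrightarrow> red_hom_vanishes (joint M {}) j"
      using \<sigma>(1) psubset.prems by (intro psubset.IH) auto
    finally show ?thesis .
  qed simp
qed

text \<open>For maximal \<open>\<tau>\<close>, a simplex containing the copy of
  \<open>\<tau>\<close> has exactly \<open>\<tau>\<close> as its part in \<open>M\<close>, so every
  member of its chain contains \<open>\<tau>\<close>. Hence \<open>Inr \<tau>\<close>, available by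
  \<open>M - {{}} \<subseteq> U\<close>, is an apex. Maximality also keeps
  \<open>M - {\<tau>}\<close> a complex.\<close>

lemma red_hom_vanishes_joint_right:
  assumes "finite M" and "simplicial_complex M" "{} \<in> M" and U: "finite U" "M - {{}} \<subseteq> U"
  shows "red_hom_vanishes (joint M U) j \<longleftrightarrow> red_hom_vanishes (joint {{}} U) j"
  using assms
proof (induction M rule: finite_psubset_induct)
  case (psubset M)
  show ?case
  proof (cases "M = {{}}")
    case False
    then have "M - {{}} \<noteq> {}" using psubset.prems by auto
    then obtain \<tau> where \<tau>: "\<tau> \<in> M" "\<tau> \<noteq> {}" and max: "\<And>\<tau>'. \<tau>' \<in> M \<Longrightarrow> \<tau> \<subseteq> \<tau>' \<Longrightarrow> \<tau>' = \<tau>"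
      using finite_has_maximal[of "M - {{}}"] psubset.hyps(1)
      by (metis DiffD1 DiffD2 DiffI finite_Diff singletonD singletonI subset_empty)
    have "red_hom_vanishes (joint M U) j
        \<longleftrightarrow> red_hom_vanishes {\<rho> \<in> joint M U. \<not> Inl ` \<tau> \<subseteq> \<rho>} j"
    proof (rule red_hom_vanishes_remove_simplex)
      show "simplicial_complex (joint M U)"
        using psubset.prems by (intro simplicial_complex_joint)
      show "Inl ` \<tau> \<in> joint M U"
        using \<tau> by (simp add: joint_def order_complex_def)
      show "Inl ` \<tau> \<noteq> {}" "Inr \<tau> \<notin> Inl ` \<tau>" using \<tau> by auto
    next
      fix \<rho> assume \<rho>: "\<rho> \<in> joint M U" "Inl ` \<tau> \<subseteq> \<rho>"
      have vim: "Inl -` insert (Inr \<tau>) \<rho> = Inl -` \<rho>" "Inr -` insert (Inr \<tau>) \<rho> = insert \<tau> (Inr -` \<rho>)"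
        by auto
      have "Inl -` \<rho> = \<tau>" using \<rho> by (intro max) (auto simp: joint_def)
      then show "insert (Inr \<tau>) \<rho> \<in> joint M U"
        using \<rho>(1) \<tau> psubset.prems unfolding joint_def order_complex_def mem_Collect_eq vim by auto
    qed
    also have "{\<rho> \<in> joint M U. \<not> Inl ` \<tau> \<subseteq> \<rho>} = joint (M - {\<tau>}) U"
    proof -
      have "\<not> Inl ` \<tau> \<subseteq> \<rho> \<longleftrightarrow> Inl -` \<rho> \<noteq> \<tau>" if "Inl -` \<rho> \<in> M" for \<rho> :: "('a + 'a set) set"
        using max[OF that] by (auto simp: image_subset_iff_subset_vimage)
      then show ?thesis by (auto simp: joint_def)
    qed
    also have "red_hom_vanishes \<dots> j \<longleftrightarrow> red_hom_vanishes (joint {{}} U) j"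
    proof (rule psubset.IH)
      show "simplicial_complex (M - {\<tau>})"
        using psubset.prems(1) max unfolding simplicial_complex_def by auto
    qed (use \<tau> psubset.prems in auto)
    finally show ?thesis .
  qed simp
qed

lemma joint_empty_right: "joint M {} = (`) Inl ` M"
proof (rule set_eqI)
  fix \<rho> :: "('a + 'a set) set"
  have "\<rho> = Inl ` (Inl -` \<rho>)" if "Inr -` \<rho> = {}" using that by (intro sum_set_eqI) auto
  then show "\<rho> \<in> joint M {} \<longleftrightarrow> \<rho> \<in> (`) Inl ` M"
    by (auto simp: joint_def order_complex_def simp del: image_vimage_eq
        intro: image_eqI[of _ _ "Inl -` \<rho>"])
qed

lemma joint_empty_left: "joint {{}} U = (`) Inr ` order_complex U"
proof (rule set_eqI)
  fix \<rho> :: "('a + 'a set) set"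
  have "\<rho> = Inr ` (Inr -` \<rho>)" if "Inl -` \<rho> = {}" using that by (intro sum_set_eqI) auto
  then show "\<rho> \<in> joint {{}} U \<longleftrightarrow> \<rho> \<in> (`) Inr ` order_complex U"
    by (auto simp: joint_def simp del: image_vimage_eq intro: image_eqI[of _ _ "Inr -` \<rho>"])
qed

text \<open>The joint complex of both sides reduces to each of them. Nonempty simplices inside
  \<open>W\<close> meet \<open>W\<close>, as one reduction requires; for the other, a vertex of
  \<open>\<sigma>\<close> in \<open>W\<close> serves as apex.\<close>

lemma eta_H_order_complex:
  assumes C: "simplicial_complex C" "{} \<in> C"
  shows "eta_H (order_complex {\<sigma> \<in> C. \<sigma> \<inter> W \<noteq> {}}) = eta_H (induced C W)"
proof -
  let ?U = "{\<sigma> \<in> C. \<sigma> \<inter> W \<noteq> {}}" and ?M = "induced C W"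
  have M: "simplicial_complex ?M" "{} \<in> ?M"
    using C unfolding simplicial_complex_def induced_def by auto
  have fin: "finite ?M" "finite ?U"
    using C(1) unfolding simplicial_complex_def induced_def by auto
  have "red_hom_vanishes (order_complex ?U) j \<longleftrightarrow> red_hom_vanishes ?M j" for j
  proof -
    have "red_hom_vanishes ?M j \<longleftrightarrow> red_hom_vanishes (joint ?M {}) j"
      unfolding joint_empty_right by (rule red_hom_vanishes_image[symmetric]) (auto simp: M)
    also have "\<dots> \<longleftrightarrow> red_hom_vanishes (joint ?M ?U) j"
    proof (rule red_hom_vanishes_joint_left[symmetric, OF M fin(2)])
      fix \<sigma> assume "\<sigma> \<in> ?U"
      then obtain w where "\<sigma> \<in> C" "w \<in> \<sigma>" "w \<in> W" by auto
      then show "\<exists>w. \<forall>\<tau>\<in>?M. \<tau> \<subseteq> \<sigma> \<longrightarrow> insert w \<tau> \<in> ?M \<and> w \<in> \<sigma>"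
        using C(1) unfolding simplicial_complex_def induced_def by (intro exI[of _ w]) auto
    qed
    also have "\<dots> \<longleftrightarrow> red_hom_vanishes (joint {{}} ?U) j"
      using fin M by (intro red_hom_vanishes_joint_right) (auto simp: induced_def)
    also have "\<dots> \<longleftrightarrow> red_hom_vanishes (order_complex ?U) j"
      unfolding joint_empty_left using fin
      by (intro red_hom_vanishes_image simplicial_complex_order_complex) auto
    finally show ?thesis ..
  qed
  then show ?thesis by (simp add: eta_H_def)
qed

text \<open>The least member of a nonempty finite chain lies in some \<open>U i\<close>, and upward
  closure pulls the whole chain into the same \<open>U i\<close>. The empty chain needs
  \<open>J \<noteq> {}\<close>.\<close>

lemma order_complex_UN_upset:
  assumes "J \<noteq> {}" "finite C" "\<And>i \<sigma> \<tau>. i \<in> J \<Longrightarrow> \<sigma> \<in> U i \<Longrightarrow> \<tau> \<in> C \<Longrightarrow> \<sigma> \<subseteq> \<tau> \<Longrightarrow> \<tau> \<in> U i"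
    and "\<And>i. i \<in> J \<Longrightarrow> U i \<subseteq> C"
  shows "order_complex (\<Union>i\<in>J. U i) = (\<Union>i\<in>J. order_complex (U i))"
proof (rule set_eqI, rule iffI)
  fix S assume S: "S \<in> order_complex (\<Union>i\<in>J. U i)"
  show "S \<in> (\<Union>i\<in>J. order_complex (U i))"
  proof (cases "S = {}")
    case True
    then show ?thesis using assms(1) by (auto simp: order_complex_def)
  next
    case False
    have SC: "S \<subseteq> C" using S assms(4) by (fastforce simp: order_complex_def)
    then obtain \<sigma> where "\<sigma> \<in> S" "\<And>\<tau>. \<tau> \<in> S \<Longrightarrow> \<tau> \<subseteq> \<sigma> \<Longrightarrow> \<tau> = \<sigma>"
      using finite_has_minimal[of S] False finite_subset[OF SC assms(2)] by metis
    then have "\<sigma> \<subseteq> \<tau>" if "\<tau> \<in> S" for \<tau>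
      using S that by (fastforce simp: order_complex_def)
    moreover obtain i where "i \<in> J" "\<sigma> \<in> U i" using S \<open>\<sigma> \<in> S\<close> by (auto simp: order_complex_def)
    ultimately have "S \<subseteq> U i" using SC assms(3) by blast
    then show ?thesis using S \<open>i \<in> J\<close> by (auto simp: order_complex_def)
  qed
qed (auto simp: order_complex_def)

theorem theorem2p3:
  fixes C :: "'a set set" and V :: "nat \<Rightarrow> 'a set" and n m :: nat
  assumes "simplicial_complex C"
    and "n \<ge> 1"
    and "\<forall>i\<in>{1..n}. V i \<noteq> {}"
    and "\<forall>i\<in>{1..n}. \<forall>j\<in>{1..n}. i \<noteq> j \<longrightarrow> V i \<inter> V j = {}"
    and "(\<Union>i\<in>{1..n}. V i) = \<Union>C"
    and "\<forall>I. I \<subseteq> {1..n} \<and> I \<noteq> {} \<longrightarrow> eta_H (induced C (\<Union>i\<in>I. V i)) \<ge> enat (card I + m)"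
  shows "eta_H (Col C V n) \<ge> enat (m + 1)"
proof -
  define U where "U i = {\<sigma> \<in> C. \<sigma> \<inter> V i \<noteq> {}}" for i
  define K where "K i = order_complex (U i)" for i
  have ne: "{1..n} \<noteq> {}" using assms(2) by simp
  \<comment> \<open>A nonempty class provides a simplex of \<open>C\<close>, whence
    \<open>{} \<in> C\<close>, which the cone arguments rely on.\<close>
  obtain v where "v \<in> V 1" using assms(2,3) by fastforce
  then obtain \<sigma> where "\<sigma> \<in> C" using assms(2,5) by fastforce
  then have C0: "{} \<in> C" and finC: "finite C"
    using assms(1) unfolding simplicial_complex_def by auto
  have sc: "simplicial_complex (K i)" for i
    unfolding K_def U_def using finC by (intro simplicial_complex_order_complex) auto
  have eta: "enat (card J + m) \<le> eta_H (\<Union>i\<in>J. K i)" if "J \<subseteq> {1..n}" "J \<noteq> {}" for J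
  proof -
    have "(\<Union>i\<in>J. U i) = {\<sigma> \<in> C. \<sigma> \<inter> (\<Union>i\<in>J. V i) \<noteq> {}}" by (auto simp: U_def)
    moreover have "order_complex (\<Union>i\<in>J. U i) = (\<Union>i\<in>J. K i)"
      unfolding K_def
      by (rule order_complex_UN_upset[OF that(2) finC]) (auto simp: U_def)
    ultimately have "eta_H (\<Union>i\<in>J. K i) = eta_H (induced C (\<Union>i\<in>J. V i))"
      using eta_H_order_complex[OF assms(1) C0, of "\<Union>i\<in>J. V i"] by simp
    then show ?thesis using assms(6) that by simp
  qed
  \<comment> \<open>All indices go into the intersection and none into the union, so the bound is
    \<open>0 + m + 1\<close>.\<close>
  have "enat (card ({} :: nat set) + m + 1)
      \<le> eta_H ((\<Inter>i\<in>{1..n}. K i) \<union> (\<Union>i\<in>{}. K i))"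
    by (rule eta_H_INT_Un_UN[of "{1..n}" "{}" "{1..n}"]) (use ne sc eta in auto)
  \<comment> \<open>A chain lies in every \<open>K i\<close> precisely when each of its members
    meets every class.\<close>
  moreover have "(\<Inter>i\<in>{1..n}. K i) = Col C V n"
    using ne by (fastforce simp: K_def U_def order_complex_def Col_def col_vertices_def)
  ultimately show ?thesis by simp
qed

end
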